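(* Let $c:\mathbb{R}^n\times\mathbb{R}^m\to\mathbb{R}$ be Lipschitz continuous, with $c(\cdot,y)$ convex for every $y\in\mathbb{R}^m$ and $c(x,\cdot)$ concave for every $x\in\mathbb{R}^n$. Let $g:\mathbb{R}^n\to\mathbb{R}^{\hat n}$ and $h:\mathbb{R}^m\to\mathbb{R}^{\hat m}$ be continuously differentiable, let $X\subset\mathbb{R}^n$ and $Y\subset\mathbb{R}^m$ be convex and compact, and let $\lambda_1,\lambda_2>0$. Let $\rho:\mathbb{R}\to[0,+\infty)$ be a piecewise continuous density function with $\rho(s)=0$ for all $s\notin[0,\alpha]$, where $\alpha>0$, and let $r(t,\mu)=\int_{-\infty}^{t/\mu}\rho(s)\,ds$. Consider $$(\mathrm{P})\quad \min_{x\in X}\max_{y\in Y} f(x,y):=c(x,y)+\lambda_1\|g(x)_+\|_0-\lambda_2\|h(y)_+\|_0,$$ $$(\mathrm{P}_\mu)\quad \min_{x\in X}\max_{y\in Y} f^R(x,y,\mu):=c(x,y)+\lambda_1\sum_{i=1}^{\hat n} r(g_i(x),\mu)-\lambda_2\sum_{j=1}^{\hat m} r(h_j(y),\mu).$$ Let $\mu>0$ be such that the following two conditions hold: - if $x^*$ is a global minimizer of $x\mapsto\max_{y\in Y}f^R(x,y,\mu)$ on $X$, then $g_i(x^* )\notin(0,\alpha\mu)$ for all $i\in\{1,\dots,\hat n\}$; - for any $\bar x\in X$, if $y^*$ is a global maximizer of $f^R(\bar x,\cdot,\mu)$ on $Y$, then $h_j(y^* )\notin(0,\alpha\mu)$ for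 all $j\in\{1,\dots,\hat m\}$. Then $(x^*,y^* )$ is a global minimax point of $(\mathrm{P}_\mu)$ if and only if it is a global minimax point of $(\mathrm{P})$.
   Context: For $a\in\mathbb{R}^k$, $\|a_+\|_0$ denotes the number of indices $i$ with $a_i>0$. A density function is a nonnegative function with integral $1$. A point $(x^*,y^* )\in X\times Y$ is a global minimax point of $\min_{x\in X}\max_{y\in Y}F(x,y)$ if $F(x^*,y)\le F(x^*,y^* )\le\max_{y'\in Y}F(x,y')$ for all $(x,y)\in X\times Y$. *)

theory Defs
  imports "HOL-Analysis.Analysis"
begin

definition cont_differentiable :: "('a::euclidean_space \<Rightarrow> 'b::euclidean_space) \<Rightarrow> bool" where
  "cont_differentiable g \<longleftrightarrow>
     (\<exists>g' :: 'a \<Rightarrow> 'a \<Rightarrow>\<^sub>L 'b.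
        (\<forall>x. (g has_derivative blinfun_apply (g' x)) (at x)) \<and> continuous_on UNIV g')"

definition piecewise_continuous :: "(real \<Rightarrow> real) \<Rightarrow> bool" where
  "piecewise_continuous \<rho> \<longleftrightarrow>
     (\<forall>a b. finite {s \<in> {a..b}. \<not> isCont \<rho> s}) \<and>
     (\<forall>s. (\<exists>l. (\<rho> \<longlongrightarrow> l) (at_left s)) \<and> (\<exists>l. (\<rho> \<longlongrightarrow> l) (at_right s)))"

definition density_function :: "(real \<Rightarrow> real) \<Rightarrow> bool" where
  "density_function \<rho> \<longleftrightarrow> (\<forall>s. 0 \<le> \<rho> s) \<and> (\<rho> has_integral 1) UNIV"

definition pos_l0 :: "real ^ 'k \<Rightarrow> nat" where
  "pos_l0 a = card {i. a $ i > 0}"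

definition smoothed_step :: "(real \<Rightarrow> real) \<Rightarrow> real \<Rightarrow> real \<Rightarrow> real" where
  "smoothed_step \<rho> t \<mu> = integral {..t / \<mu>} \<rho>"

definition obj ::
  "(real ^ 'n \<Rightarrow> real ^ 'm \<Rightarrow> real) \<Rightarrow> (real ^ 'n \<Rightarrow> real ^ 'p) \<Rightarrow> (real ^ 'm \<Rightarrow> real ^ 'q)
     \<Rightarrow> real \<Rightarrow> real \<Rightarrow> real ^ 'n \<Rightarrow> real ^ 'm \<Rightarrow> real" where
  "obj c g h lam1 lam2 x y = c x y + lam1 * real (pos_l0 (g x)) - lam2 * real (pos_l0 (h y))"

definition obj_smoothed ::
  "(real ^ 'n \<Rightarrow> real ^ 'm \<Rightarrow> real) \<Rightarrow> (real ^ 'n \<Rightarrow> real ^ 'p) \<Rightarrow> (real ^ 'm \<Rightarrow> real ^ 'q)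
     \<Rightarrow> real \<Rightarrow> real \<Rightarrow> (real \<Rightarrow> real) \<Rightarrow> real \<Rightarrow> real ^ 'n \<Rightarrow> real ^ 'm \<Rightarrow> real" where
  "obj_smoothed c g h lam1 lam2 \<rho> \<mu> x y =
     c x y + lam1 * (\<Sum>i\<in>UNIV. smoothed_step \<rho> (g x $ i) \<mu>)
           - lam2 * (\<Sum>j\<in>UNIV. smoothed_step \<rho> (h y $ j) \<mu>)"

(* The maximum over Y is written as a real supremum. The two agree whenever F x attains its
   maximum on Y; this holds for obj and obj_smoothed if Y is compact and nonempty, both being
   upper semicontinuous in y. For F x unbounded above on Y the real supremum is meaningless. *)
definition global_minimax_point ::
  "('a \<Rightarrow> 'b \<Rightarrow> real) \<Rightarrow> 'a set \<Rightarrow> 'b set \<Rightarrow> 'a \<Rightarrow> 'b \<Rightarrow> bool" where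
  "global_minimax_point F X Y x\<^sub>0 y\<^sub>0 \<longleftrightarrow> x\<^sub>0 \<in> X \<and> y\<^sub>0 \<in> Y \<and>
     (\<forall>x\<in>X. \<forall>y\<in>Y. F x\<^sub>0 y \<le> F x\<^sub>0 y\<^sub>0 \<and> F x\<^sub>0 y\<^sub>0 \<le> (SUP y'\<in>Y. F x y'))"

end

theory Submission
  imports Defs
begin

text \<open>
  The objective splits as \<open>c x y + a x - b y\<close>, and smoothing only replaces the counting terms
  \<open>a'\<close>, \<open>b'\<close> by smaller ones \<open>a\<close>, \<open>b\<close>, because the smoothed step never exceeds the
  indicator of the positive reals. The two steps agree outside the open interval from \<open>0\<close> to
  \<open>\<alpha> * \<mu>\<close>, so the two hypotheses on this interval say that \<open>a = a'\<close> and \<open>b = b'\<close> at the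
  optimizers of the smoothed problem.

  The engine is an elementary fact (\<open>arg_min_majorant\<close>): if \<open>u \<le> v\<close>, if \<open>u\<close> attains its
  minimum, and if \<open>v = u\<close> at every minimizer of \<open>u\<close>, then \<open>u\<close> and \<open>v\<close> have the same minimizers
  and the same minimum. Applied with signs reversed to the inner maximization, it shows that for
  each \<open>x\<close> the maximizers over \<open>y\<close> coincide, so that the two inner maxima differ exactly by
  \<open>a' x - a x\<close>. Applied again to the inner maxima as functions of \<open>x\<close>, it shows that the outer
  minimizers coincide (\<open>separable_minimax_iff\<close>). A global minimax point is nothing but an outer
  minimizer together with an inner maximizer, which gives the equivalence.

  What remains is attainment for the smoothed problem, which is where compactness enters: the
  smoothed step is continuous, being an indefinite integral, and the maximum over a compact set
  of a jointly continuous function is continuous in the parameter.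
\<close>

section \<open>Minimizers of a function and of a majorant\<close>

lemma arg_min_majorant:
  fixes u v :: "'a \<Rightarrow> 'b::linorder"
  assumes le: "\<And>x. P x \<Longrightarrow> u x \<le> v x"
    and attained: "\<exists>x. is_arg_min u P x"
    and touch: "\<And>x. is_arg_min u P x \<Longrightarrow> v x = u x"
  shows "is_arg_min v P x \<longleftrightarrow> is_arg_min u P x"
proof
  assume u: "is_arg_min u P x"
  show "is_arg_min v P x"
    using u touch[OF u] le unfolding is_arg_min_linorder by (metis order_trans)
next
  assume v: "is_arg_min v P x"
  obtain a where a: "is_arg_min u P a"
    using attained by blast
  have "u x \<le> v x" and "v x \<le> v a"
    using v a le unfolding is_arg_min_linorder by auto
  then have "u x \<le> u a"
    using touch[OF a] by simp
  then show "is_arg_min u P x"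
    using v a unfolding is_arg_min_linorder by (meson order_trans)
qed

lemma is_arg_max_iff_is_arg_min_uminus:
  fixes f :: "'a \<Rightarrow> real"
  shows "is_arg_max f P x \<longleftrightarrow> is_arg_min (\<lambda>x. - f x) P x"
  by (simp add: is_arg_max_def is_arg_min_def)

lemma is_arg_max_add_const:
  fixes f :: "'a \<Rightarrow> real"
  shows "is_arg_max (\<lambda>x. f x + k) P x \<longleftrightarrow> is_arg_max f P x"
  by (simp add: is_arg_max_def)

lemma is_arg_max_imp_SUP_eq:
  fixes f :: "'a \<Rightarrow> real"
  assumes "is_arg_max f (\<lambda>y. y \<in> Y) y"
  shows "(SUP y\<in>Y. f y) = f y"
  using assms unfolding is_arg_max_linorder by (intro cSup_eq_maximum) auto

section \<open>Minimax points of separable perturbations\<close>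

text \<open>
  Attainment of the inner maxima makes the real supremum in the definition of a minimax point an
  actual maximum, which splits the definition into an outer and an inner optimality condition.
\<close>

lemma global_minimax_point_iff:
  fixes F :: "'a \<Rightarrow> 'b \<Rightarrow> real"
  assumes attained: "\<And>x. x \<in> X \<Longrightarrow> \<exists>y. is_arg_max (F x) (\<lambda>y. y \<in> Y) y"
  shows "global_minimax_point F X Y x\<^sub>0 y\<^sub>0 \<longleftrightarrow>
    is_arg_min (\<lambda>x. SUP y\<in>Y. F x y) (\<lambda>x. x \<in> X) x\<^sub>0 \<and> is_arg_max (F x\<^sub>0) (\<lambda>y. y \<in> Y) y\<^sub>0"
proof
  assume A: "global_minimax_point F X Y x\<^sub>0 y\<^sub>0"
  then have y0: "is_arg_max (F x\<^sub>0) (\<lambda>y. y \<in> Y) y\<^sub>0"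
    unfolding global_minimax_point_def is_arg_max_linorder by auto
  show "is_arg_min (\<lambda>x. SUP y\<in>Y. F x y) (\<lambda>x. x \<in> X) x\<^sub>0 \<and> is_arg_max (F x\<^sub>0) (\<lambda>y. y \<in> Y) y\<^sub>0"
    using A y0 is_arg_max_imp_SUP_eq[OF y0]
    unfolding global_minimax_point_def is_arg_min_linorder by auto
next
  assume A: "is_arg_min (\<lambda>x. SUP y\<in>Y. F x y) (\<lambda>x. x \<in> X) x\<^sub>0 \<and>
    is_arg_max (F x\<^sub>0) (\<lambda>y. y \<in> Y) y\<^sub>0"
  then have "(SUP y\<in>Y. F x\<^sub>0 y) = F x\<^sub>0 y\<^sub>0"
    by (intro is_arg_max_imp_SUP_eq) simp
  then show "global_minimax_point F X Y x\<^sub>0 y\<^sub>0"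
    using A unfolding global_minimax_point_def is_arg_min_linorder is_arg_max_linorder by auto
qed

text \<open>
  Passing from \<open>a\<close> to \<open>a'\<close> penalizes the minimizing player and passing from \<open>b\<close> to \<open>b'\<close> the
  maximizing player. Neither player moves if the extra penalty vanishes at each of that player's
  optima. The extra penalty on \<open>y\<close> then leaves the inner maximal values unchanged, so the two
  outer problems differ by \<open>a' - a\<close> alone.
\<close>

lemma separable_minimax_iff:
  fixes c F G :: "'a \<Rightarrow> 'b \<Rightarrow> real" and a a' :: "'a \<Rightarrow> real" and b b' :: "'b \<Rightarrow> real"
  assumes F: "\<And>x y. F x y = c x y + a x - b y"
    and G: "\<And>x y. G x y = c x y + a' x - b' y"
    and a_le: "\<And>x. x \<in> X \<Longrightarrow> a x \<le> a' x"
    and b_le: "\<And>y. y \<in> Y \<Longrightarrow> b y \<le> b' y"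
    and max_attained: "\<And>x. x \<in> X \<Longrightarrow> \<exists>y. is_arg_max (F x) (\<lambda>y. y \<in> Y) y"
    and b_eq: "\<And>x y. x \<in> X \<Longrightarrow> is_arg_max (F x) (\<lambda>y. y \<in> Y) y \<Longrightarrow> b' y = b y"
    and min_attained: "\<exists>x. is_arg_min (\<lambda>x. SUP y\<in>Y. F x y) (\<lambda>x. x \<in> X) x"
    and a_eq: "\<And>x. is_arg_min (\<lambda>x. SUP y\<in>Y. F x y) (\<lambda>x. x \<in> X) x \<Longrightarrow> a' x = a x"
  shows "global_minimax_point F X Y x\<^sub>0 y\<^sub>0 \<longleftrightarrow> global_minimax_point G X Y x\<^sub>0 y\<^sub>0"
proof -
  have inner: "is_arg_max (G x) (\<lambda>y. y \<in> Y) y \<longleftrightarrow> is_arg_max (F x) (\<lambda>y. y \<in> Y) y"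
    if x: "x \<in> X" for x y
  proof -
    \<comment> \<open>The shift by \<open>a x - a' x\<close> leaves only the change from \<open>b\<close> to \<open>b'\<close>.\<close>
    have "is_arg_min (\<lambda>y. - (G x y + (a x - a' x))) (\<lambda>y. y \<in> Y) y
        \<longleftrightarrow> is_arg_min (\<lambda>y. - F x y) (\<lambda>y. y \<in> Y) y"
      using b_le max_attained[OF x] b_eq[OF x]
      by (intro arg_min_majorant)
        (auto simp: F G is_arg_max_iff_is_arg_min_uminus)
    then show ?thesis
      by (metis is_arg_max_iff_is_arg_min_uminus is_arg_max_add_const)
  qed
  have inner_max: "(SUP y\<in>Y. G x y) = (SUP y\<in>Y. F x y) + (a' x - a x)" if x: "x \<in> X" for x
  proof -
    obtain y where y: "is_arg_max (F x) (\<lambda>y. y \<in> Y) y"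
      using max_attained[OF x] by blast
    then have "is_arg_max (G x) (\<lambda>y. y \<in> Y) y"
      using inner[OF x] by blast
    then show ?thesis
      using is_arg_max_imp_SUP_eq[OF y] is_arg_max_imp_SUP_eq[of "G x"] b_eq[OF x y]
      by (simp add: F G)
  qed
  have outer: "is_arg_min (\<lambda>x. SUP y\<in>Y. G x y) (\<lambda>x. x \<in> X) x
      \<longleftrightarrow> is_arg_min (\<lambda>x. SUP y\<in>Y. F x y) (\<lambda>x. x \<in> X) x" for x
  proof (rule arg_min_majorant)
    show "(SUP y\<in>Y. F x y) \<le> (SUP y\<in>Y. G x y)" if "x \<in> X" for x
      using inner_max[OF that] a_le[OF that] by simp
    show "(SUP y\<in>Y. G x y) = (SUP y\<in>Y. F x y)"
      if "is_arg_min (\<lambda>x. SUP y\<in>Y. F x y) (\<lambda>x. x \<in> X) x" for x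
      using inner_max[of x] a_eq[OF that] that by (simp add: is_arg_min_def)
  qed (rule min_attained)
  have "global_minimax_point F X Y x\<^sub>0 y\<^sub>0 \<longleftrightarrow>
      is_arg_min (\<lambda>x. SUP y\<in>Y. F x y) (\<lambda>x. x \<in> X) x\<^sub>0 \<and> is_arg_max (F x\<^sub>0) (\<lambda>y. y \<in> Y) y\<^sub>0"
    by (rule global_minimax_point_iff) (rule max_attained)
  also have "\<dots> \<longleftrightarrow>
      is_arg_min (\<lambda>x. SUP y\<in>Y. G x y) (\<lambda>x. x \<in> X) x\<^sub>0 \<and> is_arg_max (G x\<^sub>0) (\<lambda>y. y \<in> Y) y\<^sub>0"
    using outer inner[of x\<^sub>0] by (auto simp: is_arg_min_def)
  also have "\<dots> \<longleftrightarrow> global_minimax_point G X Y x\<^sub>0 y\<^sub>0"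
    by (rule global_minimax_point_iff[symmetric]) (use max_attained inner in blast)
  finally show ?thesis .
qed

section \<open>Attainment on compact sets\<close>

lemma continuous_attains_arg_min:
  fixes f :: "'a::topological_space \<Rightarrow> real"
  assumes "compact A" "A \<noteq> {}" "continuous_on A f"
  shows "\<exists>x. is_arg_min f (\<lambda>x. x \<in> A) x"
  using continuous_attains_inf[OF assms] by (auto simp: is_arg_min_linorder)

lemma continuous_attains_arg_max:
  fixes f :: "'a::topological_space \<Rightarrow> real"
  assumes "compact A" "A \<noteq> {}" "continuous_on A f"
  shows "\<exists>x. is_arg_max f (\<lambda>x. x \<in> A) x"
  using continuous_attains_sup[OF assms] by (auto simp: is_arg_max_linorder)

text \<open>
  On the compact product the function is uniformly continuous, so a small change of the parameter
  moves all its values over \<open>Y\<close>, and hence their maximum, by a uniformly small amount.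
\<close>

lemma continuous_on_SUP_compact:
  fixes F :: "'a::metric_space \<Rightarrow> 'b::metric_space \<Rightarrow> real"
  assumes "compact X" "compact Y" "Y \<noteq> {}"
    and cont: "continuous_on (X \<times> Y) (\<lambda>(x, y). F x y)"
  shows "continuous_on X (\<lambda>x. SUP y\<in>Y. F x y)"
proof -
  have unif: "uniformly_continuous_on (X \<times> Y) (\<lambda>(x, y). F x y)"
    using assms by (intro compact_uniformly_continuous compact_Times)
  have bdd: "bdd_above (F x ` Y)" if "x \<in> X" for x
  proof -
    have "continuous_on Y ((\<lambda>(x, y). F x y) \<circ> (\<lambda>y. (x, y)))"
      using that by (intro continuous_on_compose continuous_intros continuous_on_subset[OF cont]) auto
    then have "continuous_on Y (F x)"
      by (simp add: o_def)
    then show ?thesis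
      using assms(2) by (intro bounded_imp_bdd_above compact_imp_bounded compact_continuous_image)
  qed
  show ?thesis
    unfolding continuous_on_iff
  proof (intro ballI allI impI)
    fix x :: 'a and e :: real
    assume x: "x \<in> X" and e: "0 < e"
    obtain d where d: "d > 0"
      and close: "\<And>p q. p \<in> X \<times> Y \<Longrightarrow> q \<in> X \<times> Y \<Longrightarrow> dist q p < d \<Longrightarrow>
        dist (case q of (x, y) \<Rightarrow> F x y) (case p of (x, y) \<Rightarrow> F x y) < e / 2"
      using unif e unfolding uniformly_continuous_on_def by (metis half_gt_zero)
    have le: "(SUP y\<in>Y. F u y) \<le> (SUP y\<in>Y. F v y) + e / 2"
      if "u \<in> X" "v \<in> X" "dist u v < d" for u v
    proof (rule cSUP_least[OF \<open>Y \<noteq> {}\<close>])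
      fix y assume y: "y \<in> Y"
      have "dist (F u y) (F v y) < e / 2"
        using close[of "(v, y)" "(u, y)"] that y by (simp add: dist_Pair_Pair)
      then have "F u y \<le> F v y + e / 2"
        unfolding dist_real_def by linarith
      also have "F v y \<le> (SUP y\<in>Y. F v y)"
        using y bdd[OF \<open>v \<in> X\<close>] by (rule cSUP_upper)
      finally show "F u y \<le> (SUP y\<in>Y. F v y) + e / 2" by simp
    qed
    show "\<exists>d>0. \<forall>u\<in>X. dist u x < d \<longrightarrow> dist (SUP y\<in>Y. F u y) (SUP y\<in>Y. F x y) < e"
    proof (intro exI[of _ d] conjI ballI impI d)
      fix u assume "u \<in> X" "dist u x < d"
      then show "dist (SUP y\<in>Y. F u y) (SUP y\<in>Y. F x y) < e"
        using le[of u x] le[of x u] x e by (auto simp: dist_real_def dist_commute abs_less_iff)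
    qed
  qed
qed

section \<open>The smoothed step function\<close>

lemma pos_l0_eq_sum: "real (pos_l0 a) = (\<Sum>i\<in>UNIV. of_bool (a $ i > 0))"
  by (simp add: pos_l0_def)

context
  fixes \<rho> :: "real \<Rightarrow> real" and \<alpha> \<mu> :: real
  assumes density: "density_function \<rho>"
    and support: "\<And>s. s \<notin> {0..\<alpha>} \<Longrightarrow> \<rho> s = 0"
    and mu: "\<mu> > 0"
begin

lemma smoothed_step_eq_integral_from_0:
  "smoothed_step \<rho> t \<mu> = integral {0..min (t / \<mu>) \<alpha>} \<rho>"
proof -
  have "(\<lambda>s. if s \<in> {..t / \<mu>} then \<rho> s else 0)
      = (\<lambda>s. if s \<in> {0..min (t / \<mu>) \<alpha>} then \<rho> s else 0)"
    using support by auto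
  then show ?thesis
    unfolding smoothed_step_def
    by (subst (1 2) integral_restrict_UNIV[symmetric]) (rule arg_cong[where f = "integral UNIV"])
qed

lemma density_integrable_on_interval: "\<rho> integrable_on {u..v}"
  using density unfolding density_function_def
  by (meson has_integral_integrable integrable_on_subinterval subset_UNIV)

lemma integral_support_eq_1: "integral {0..\<alpha>} \<rho> = 1"
proof -
  have "(\<lambda>s. if s \<in> {0..\<alpha>} then \<rho> s else 0) = \<rho>"
    using support by auto
  then have "integral {0..\<alpha>} \<rho> = integral UNIV \<rho>"
    by (metis integral_restrict_UNIV)
  then show ?thesis
    using density by (simp add: density_function_def integral_unique)
qed

lemma smoothed_step_eq_0:
  assumes "t \<le> 0"
  shows "smoothed_step \<rho> t \<mu> = 0"
proof -
  \<comment> \<open>The interval is empty, or the single point \<open>0\<close> when \<open>t = 0\<close>.\<close>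
  have "t / \<mu> \<le> 0"
    using assms mu by (simp add: divide_nonpos_pos)
  then have "{0..min (t / \<mu>) \<alpha>} = {} \<or> {0..min (t / \<mu>) \<alpha>} = {0}"
    by auto
  then show ?thesis
    unfolding smoothed_step_eq_integral_from_0 by auto
qed

lemma smoothed_step_eq_1:
  assumes "\<alpha> * \<mu> \<le> t"
  shows "smoothed_step \<rho> t \<mu> = 1"
proof -
  have "min (t / \<mu>) \<alpha> = \<alpha>"
    using assms mu by (simp add: pos_le_divide_eq)
  then show ?thesis
    unfolding smoothed_step_eq_integral_from_0 by (simp add: integral_support_eq_1)
qed

lemma smoothed_step_le_1: "smoothed_step \<rho> t \<mu> \<le> 1"
proof -
  have "integral {0..min (t / \<mu>) \<alpha>} \<rho> \<le> integral {0..\<alpha>} \<rho>"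
    using density
    by (intro integral_subset_le density_integrable_on_interval) (auto simp: density_function_def)
  then show ?thesis
    unfolding smoothed_step_eq_integral_from_0 by (simp add: integral_support_eq_1)
qed

lemma smoothed_step_le_of_bool: "smoothed_step \<rho> t \<mu> \<le> of_bool (t > 0)"
  using smoothed_step_eq_0[of t] smoothed_step_le_1[of t] by (cases "t > 0") auto

lemma smoothed_step_eq_of_bool:
  assumes "t \<notin> {0<..<\<alpha> * \<mu>}"
  shows "smoothed_step \<rho> t \<mu> = of_bool (t > 0)"
  using assms smoothed_step_eq_0[of t] smoothed_step_eq_1[of t] by (cases "t > 0") auto

lemma continuous_on_smoothed_step: "continuous_on UNIV (\<lambda>t. smoothed_step \<rho> t \<mu>)"
proof -
  \<comment> \<open>Starting the interval at \<open>-1\<close> adds nothing and keeps the clamped upper limit inside a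
    compact interval on which the indefinite integral is continuous.\<close>
  let ?clamp = "\<lambda>t. max (- 1) (min (t / \<mu>) \<alpha>)"
  have eq: "smoothed_step \<rho> t \<mu> = integral {-1..?clamp t} \<rho>" for t
  proof (cases "t / \<mu> < - 1")
    case True
    then have "t \<le> 0"
      using mu by (simp add: pos_divide_less_eq)
    moreover have "{-1..?clamp t} = {-1}"
      using True by auto
    ultimately show ?thesis
      using smoothed_step_eq_0 by simp
  next
    case False
    have "(\<lambda>s. if s \<in> {..t / \<mu>} then \<rho> s else 0)
      = (\<lambda>s. if s \<in> {-1..?clamp t} then \<rho> s else 0)"
      using support False by (fastforce simp: fun_eq_iff max_def min_def)
    then show ?thesis
      unfolding smoothed_step_def
      by (subst (1 2) integral_restrict_UNIV[symmetric]) (rule arg_cong[where f = "integral UNIV"])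
  qed
  have "continuous_on UNIV (\<lambda>t. integral {-1..?clamp t} \<rho>)"
  proof (rule continuous_on_compose2[where f = ?clamp and t = "{-1..max (- 1) \<alpha>}"])
    show "continuous_on {-1..max (- 1) \<alpha>} (\<lambda>u. integral {-1..u} \<rho>)"
      by (intro indefinite_integral_continuous_1 density_integrable_on_interval)
    show "continuous_on UNIV ?clamp"
      using mu by (intro continuous_intros) auto
  qed auto
  then show ?thesis
    by (simp add: eq)
qed

lemma sum_smoothed_step_le_pos_l0:
  "(\<Sum>i\<in>UNIV. smoothed_step \<rho> (a $ i) \<mu>) \<le> real (pos_l0 a)"
  unfolding pos_l0_eq_sum by (intro sum_mono smoothed_step_le_of_bool)

lemma sum_smoothed_step_eq_pos_l0:
  assumes "\<And>i. a $ i \<notin> {0<..<\<alpha> * \<mu>}"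
  shows "(\<Sum>i\<in>UNIV. smoothed_step \<rho> (a $ i) \<mu>) = real (pos_l0 a)"
  unfolding pos_l0_eq_sum using assms by (intro sum.cong smoothed_step_eq_of_bool) auto

lemma continuous_on_sum_smoothed_step:
  fixes k :: "'a::topological_space \<Rightarrow> real ^ 'k"
  assumes "continuous_on A k"
  shows "continuous_on A (\<lambda>x. \<Sum>i\<in>UNIV. smoothed_step \<rho> (k x $ i) \<mu>)"
  using assms
  by (intro continuous_on_sum continuous_on_compose2[OF continuous_on_smoothed_step]
      continuous_on_component) auto

end

section \<open>Equivalence of the original and the smoothed minimax problem\<close>

lemma cont_differentiable_imp_continuous_on:
  "cont_differentiable g \<Longrightarrow> continuous_on A g"
  unfolding cont_differentiable_def
  by (blast intro: continuous_at_imp_continuous_on has_derivative_continuous)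

theorem theorem4p2:
  fixes c :: "real ^ 'n \<Rightarrow> real ^ 'm \<Rightarrow> real"
    and g :: "real ^ 'n \<Rightarrow> real ^ 'p"
    and h :: "real ^ 'm \<Rightarrow> real ^ 'q"
    and X :: "(real ^ 'n) set" and Y :: "(real ^ 'm) set"
    and \<rho> :: "real \<Rightarrow> real"
    and lam1 lam2 \<alpha> \<mu> :: real
    and x\<^sub>0 :: "real ^ 'n" and y\<^sub>0 :: "real ^ 'm"
  assumes "\<exists>L. L-lipschitz_on UNIV (\<lambda>(x, y). c x y)"
    and "\<And>y. convex_on UNIV (\<lambda>x. c x y)"
    and "\<And>x. concave_on UNIV (\<lambda>y. c x y)"
    and "cont_differentiable g" and "cont_differentiable h"
    and "convex X" and "compact X" and "convex Y" and "compact Y"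
    and "lam1 > 0" and "lam2 > 0"
    and "density_function \<rho>" and "piecewise_continuous \<rho>"
    and "\<alpha> > 0" and "\<And>s. s \<notin> {0..\<alpha>} \<Longrightarrow> \<rho> s = 0"
    and "\<mu> > 0"
    and "\<And>x i. is_arg_min (\<lambda>x. SUP y\<in>Y. obj_smoothed c g h lam1 lam2 \<rho> \<mu> x y) (\<lambda>x. x \<in> X) x
           \<Longrightarrow> g x $ i \<notin> {0<..<\<alpha> * \<mu>}"
    and "\<And>x y j. x \<in> X \<Longrightarrow> is_arg_max (obj_smoothed c g h lam1 lam2 \<rho> \<mu> x) (\<lambda>y. y \<in> Y) y
           \<Longrightarrow> h y $ j \<notin> {0<..<\<alpha> * \<mu>}"
  shows "global_minimax_point (obj_smoothed c g h lam1 lam2 \<rho> \<mu>) X Y x\<^sub>0 y\<^sub>0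
     \<longleftrightarrow> global_minimax_point (obj c g h lam1 lam2) X Y x\<^sub>0 y\<^sub>0"
proof (cases "X = {} \<or> Y = {}")
  case True
  then show ?thesis
    by (auto simp: global_minimax_point_def)
next
  case False
  note step = \<open>density_function \<rho>\<close> \<open>\<And>s. s \<notin> {0..\<alpha>} \<Longrightarrow> \<rho> s = 0\<close> \<open>\<mu> > 0\<close>
  note gap_g = assms(17) and gap_h = assms(18)
  let ?a = "\<lambda>x. lam1 * (\<Sum>i\<in>UNIV. smoothed_step \<rho> (g x $ i) \<mu>)"
  let ?b = "\<lambda>y. lam2 * (\<Sum>j\<in>UNIV. smoothed_step \<rho> (h y $ j) \<mu>)"
  let ?a' = "\<lambda>x. lam1 * real (pos_l0 (g x))"
  let ?b' = "\<lambda>y. lam2 * real (pos_l0 (h y))"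
  let ?F = "obj_smoothed c g h lam1 lam2 \<rho> \<mu>"
  have cont_g: "continuous_on UNIV (\<lambda>x. \<Sum>i\<in>UNIV. smoothed_step \<rho> (g x $ i) \<mu>)"
    and cont_h: "continuous_on UNIV (\<lambda>y. \<Sum>j\<in>UNIV. smoothed_step \<rho> (h y $ j) \<mu>)"
    using assms(4,5)
    by (intro continuous_on_sum_smoothed_step[OF step] cont_differentiable_imp_continuous_on; simp)+
  have "continuous_on UNIV (\<lambda>p. c (fst p) (snd p))"
    using assms(1) by (auto dest: lipschitz_on_continuous_on simp: case_prod_unfold)
  then have cont_F: "continuous_on UNIV (\<lambda>p. ?F (fst p) (snd p))"
    unfolding obj_smoothed_def
    by (intro continuous_intros continuous_on_compose2[OF cont_g] continuous_on_compose2[OF cont_h])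
      auto
  have max_attained: "\<exists>y. is_arg_max (?F x) (\<lambda>y. y \<in> Y) y" for x
  proof (rule continuous_attains_arg_max)
    show "continuous_on Y (?F x)"
      using continuous_on_compose2[OF cont_F, of Y "Pair x"]
      by (simp add: continuous_on_Pair)
  qed (use \<open>compact Y\<close> False in auto)
  have "continuous_on X (\<lambda>x. SUP y\<in>Y. ?F x y)"
    using \<open>compact X\<close> \<open>compact Y\<close> False continuous_on_subset[OF cont_F, of "X \<times> Y"]
    by (intro continuous_on_SUP_compact) (auto simp: case_prod_unfold)
  then have min_attained: "\<exists>x. is_arg_min (\<lambda>x. SUP y\<in>Y. ?F x y) (\<lambda>x. x \<in> X) x"
    using \<open>compact X\<close> False by (intro continuous_attains_arg_min) auto
  show ?thesis
  proof (rule separable_minimax_iff[where c = c and a = ?a and a' = ?a' and b = ?b and b' = ?b'])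
    show "?F x y = c x y + ?a x - ?b y" for x y
      by (simp add: obj_smoothed_def)
    show "obj c g h lam1 lam2 x y = c x y + ?a' x - ?b' y" for x y
      by (simp add: obj_def)
    show "?a x \<le> ?a' x" for x
      using sum_smoothed_step_le_pos_l0[OF step] \<open>lam1 > 0\<close> by simp
    show "?b y \<le> ?b' y" for y
      using sum_smoothed_step_le_pos_l0[OF step] \<open>lam2 > 0\<close> by simp
    show "?b' y = ?b y" if "x \<in> X" "is_arg_max (?F x) (\<lambda>y. y \<in> Y) y" for x y
      using sum_smoothed_step_eq_pos_l0[OF step gap_h[OF that]] by simp
    show "?a' x = ?a x" if "is_arg_min (\<lambda>x. SUP y\<in>Y. ?F x y) (\<lambda>x. x \<in> X) x" for x
      using sum_smoothed_step_eq_pos_l0[OF step gap_g[OF that]] by simp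
  qed (rule max_attained min_attained)+
qed

end
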